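(* Let $T_i\in\mathcal{B}_A(\mathcal{H})$ for $1\le i\le n$, let $\sigma=e^{\pi \mathrm{i}/n}$ and $\omega=e^{2\pi \mathrm{i}/n}$ (with $\mathrm{i}$ the imaginary unit), and let $\mathbb{T}_{slcirc}=\mathrm{slcirc}(T_1,\dots,T_n)$ be the skew left circulant operator matrix. Then $$w_{\mathbb{A}}(\mathbb{T}_{slcirc})=w_{\mathbb{A}}(\mathbb{E}),$$ where $\mathbb{E}$ is the $n\times n$ operator matrix whose $(k,n+1-k)$ entry is $\sum_{i=1}^n(\sigma\omega^{k-1})^{i+1}T_i$ for $1\le k\le n$ and whose other entries are all $O$; that is, from the top right corner to the bottom left corner the anti-diagonal entries of $\mathbb{E}$ are $\sum_{i=1}^n(\sigma\omega^0)^{i+1}T_i,\ \sum_{i=1}^n(\sigma\omega)^{i+1}T_i,\ \dots,\ \sum_{i=1}^n(\sigma\omega^{n-1})^{i+1}T_i$.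
   Context: $\mathcal{H}$ is a complex Hilbert space with inner product $\langle\cdot,\cdot\rangle$, $\mathcal{B}(\mathcal{H})$ is the algebra of bounded linear operators on $\mathcal{H}$, and $A\in\mathcal{B}(\mathcal{H})$ is a fixed positive operator ($\langle Ax,x\rangle\ge 0$ for all $x$). Put $\langle x,y\rangle_A=\langle Ax,y\rangle$ and $\|x\|_A=\sqrt{\langle x,x\rangle_A}$. $\mathcal{B}_A(\mathcal{H})$ is the set of $T\in\mathcal{B}(\mathcal{H})$ admitting an $A$-adjoint, i.e. for which there is $X\in\mathcal{B}(\mathcal{H})$ with $AX=T^*A$ (equivalently $\mathcal{R}(T^*A)\subseteq\mathcal{R}(A)$). The $A$-numerical radius is $w_A(T)=\sup\{|\langle Tx,x\rangle_A|: x\in\mathcal{H},\ \|x\|_A=1\}$. $\mathbb{A}$ denotes the $n\times n$ block diagonal operator matrix on $\bigoplus_{i=1}^n\mathcal{H}$ all of whose diagonal entries are $A$, and $w_{\mathbb{A}}$ is the numerical radius defined in the same way with $\mathcal{H},A$ replaced by $\bigoplus_{i=1}^n\mathcal{H},\mathbb{A}$. The skew left circulant operator matrix $\mathrm{slcirc}(T_1,\dots,T_n)$ is the $n\times n$ operator matrix obtained from the left circulant matrix by changing the sign of all entries below the anti-diagonal: its $(j,k)$ entry is $T_{j+k-1}$ if $j+k\le n+1$ and $-T_{j+k-1-n}$ if $j+k>n+1$. *)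

theory Defs
  imports "HOL-Analysis.Analysis"
begin

text \<open>Complex Hilbert spaces as a refinement of the library's real ones: the real inner product
  (and hence norm and topology) is the real part of the complex one. The inner product is linear
  in the first argument. Definiteness is inherited from \<^class>\<open>real_inner\<close>, since hermitian
  symmetry makes \<open>cinner x x\<close> real.\<close>

class complex_inner = real_inner +
  fixes scaleC :: "complex \<Rightarrow> 'a \<Rightarrow> 'a"  (infixr \<open>*\<^sub>C\<close> 75)
    and cinner :: "'a \<Rightarrow> 'a \<Rightarrow> complex"
  assumes scaleC_add_right: "c *\<^sub>C (x + y) = c *\<^sub>C x + c *\<^sub>C y"
    and scaleC_add_left: "(c + d) *\<^sub>C x = c *\<^sub>C x + d *\<^sub>C x"
    and scaleC_scaleC: "c *\<^sub>C d *\<^sub>C x = (c * d) *\<^sub>C x"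
    and scaleC_of_real: "complex_of_real r *\<^sub>C x = r *\<^sub>R x"
    and cinner_commute: "cinner x y = cnj (cinner y x)"
    and cinner_add_left: "cinner (x + y) z = cinner x z + cinner y z"
    and cinner_scaleC_left: "cinner (c *\<^sub>C x) y = c * cinner x y"
    and Re_cinner: "Re (cinner x y) = inner x y"

class complex_hilbert = complex_inner + complete_space

instantiation complex :: complex_hilbert
begin

definition scaleC_complex :: "complex \<Rightarrow> complex \<Rightarrow> complex"
  where "scaleC_complex c x = c * x"

definition cinner_complex :: "complex \<Rightarrow> complex \<Rightarrow> complex"
  where "cinner_complex x y = x * cnj y"

instance
  by standard
    (simp_all add: scaleC_complex_def cinner_complex_def algebra_simps scaleR_conv_of_real
      inner_complex_def)

end

text \<open>The direct sum of copies of a Hilbert space indexed by a finite type.\<close>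

instantiation vec :: (complex_inner, finite) complex_inner
begin

definition scaleC_vec :: "complex \<Rightarrow> 'a ^ 'b \<Rightarrow> 'a ^ 'b"
  where "scaleC_vec c x = (\<chi> i. c *\<^sub>C (x $ i))"

definition cinner_vec :: "'a ^ 'b \<Rightarrow> 'a ^ 'b \<Rightarrow> complex"
  where "cinner_vec x y = (\<Sum>i\<in>UNIV. cinner (x $ i) (y $ i))"

instance
proof
  fix x y z :: "'a ^ 'b" and c d :: complex and r :: real
  show "c *\<^sub>C (x + y) = c *\<^sub>C x + c *\<^sub>C y"
    by (simp add: scaleC_vec_def vec_eq_iff scaleC_add_right)
  show "(c + d) *\<^sub>C x = c *\<^sub>C x + d *\<^sub>C x"
    by (simp add: scaleC_vec_def vec_eq_iff scaleC_add_left)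
  show "c *\<^sub>C d *\<^sub>C x = (c * d) *\<^sub>C x"
    by (simp add: scaleC_vec_def vec_eq_iff scaleC_scaleC)
  show "complex_of_real r *\<^sub>C x = r *\<^sub>R x"
    by (simp add: scaleC_vec_def vec_eq_iff scaleC_of_real)
  show "cinner x y = cnj (cinner y x)"
    unfolding cinner_vec_def cnj_sum by (intro sum.cong refl cinner_commute)
  show "cinner (x + y) z = cinner x z + cinner y z"
    by (simp add: cinner_vec_def cinner_add_left sum.distrib)
  show "cinner (c *\<^sub>C x) y = c * cinner x y"
    by (simp add: cinner_vec_def scaleC_vec_def cinner_scaleC_left sum_distrib_left)
  show "Re (cinner x y) = inner x y"
    by (simp add: cinner_vec_def inner_vec_def Re_cinner)
qed

end

instance vec :: (complex_hilbert, finite) complex_hilbert ..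

definition bounded_clinear :: "('a::complex_inner \<Rightarrow> 'b::complex_inner) \<Rightarrow> bool"
  where "bounded_clinear T \<longleftrightarrow> bounded_linear T \<and> (\<forall>c x. T (c *\<^sub>C x) = c *\<^sub>C T x)"

text \<open>On a Hilbert space, the adjoint of a bounded operator exists uniquely, so the description
  is proper.\<close>

definition cadjoint :: "('a::complex_hilbert \<Rightarrow> 'a) \<Rightarrow> ('a \<Rightarrow> 'a)"
  where "cadjoint T = (THE S. \<forall>x y. cinner (T x) y = cinner x (S y))"

definition positive_op :: "('a::complex_hilbert \<Rightarrow> 'a) \<Rightarrow> bool"
  where "positive_op A \<longleftrightarrow> bounded_clinear A \<and> (\<forall>x. cinner (A x) x \<in> \<real>\<^sub>\<ge>\<^sub>0)"

definition A_inner :: "('a::complex_hilbert \<Rightarrow> 'a) \<Rightarrow> 'a \<Rightarrow> 'a \<Rightarrow> complex"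
  where "A_inner A x y = cinner (A x) y"

definition A_norm :: "('a::complex_hilbert \<Rightarrow> 'a) \<Rightarrow> 'a \<Rightarrow> real"
  where "A_norm A x = sqrt (Re (A_inner A x x))"

definition A_adjointable :: "('a::complex_hilbert \<Rightarrow> 'a) \<Rightarrow> ('a \<Rightarrow> 'a) set"
  where "A_adjointable A =
    {T. bounded_clinear T \<and> (\<exists>X. bounded_clinear X \<and> A \<circ> X = cadjoint T \<circ> A)}"

text \<open>The supremum is taken in \<open>[0, \<infinity>]\<close>, so that it is meaningful without a boundedness proof
  and is \<open>0\<close> when no vector has \<open>A\<close>-norm 1 (that is, when \<open>A = 0\<close>).\<close>

definition A_numerical_radius ::
    "('a::complex_hilbert \<Rightarrow> 'a) \<Rightarrow> ('a \<Rightarrow> 'a) \<Rightarrow> ennreal"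
  where "A_numerical_radius A T =
    (SUP x\<in>{x. A_norm A x = 1}. ennreal (cmod (A_inner A (T x) x)))"

text \<open>The index type \<open>'n\<close> of size \<open>n = CARD('n)\<close> is identified with \<open>{1..n}\<close> along its linear
  order.\<close>

definition idx :: "'n::{finite,linorder} \<Rightarrow> nat"
  where "idx k = card {..k}"

lemma bij_betw_idx: "bij_betw idx (UNIV :: 'n::{finite,linorder} set) {1..CARD('n)}"
proof -
  have strict: "idx i < idx j" if "i < j" for i j :: 'n
    unfolding idx_def by (rule psubset_card_mono) (use that in auto)
  have "inj (idx :: 'n \<Rightarrow> nat)"
    by (rule injI) (metis strict less_irrefl linorder_less_linear)
  moreover have "range (idx :: 'n \<Rightarrow> nat) \<subseteq> {1..CARD('n)}"
    by (auto simp: idx_def Suc_le_eq card_gt_0_iff intro!: card_mono)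
  ultimately show ?thesis
    by (simp add: bij_betw_def card_image card_subset_eq)
qed

text \<open>The operator on the direct sum given by an operator matrix with entries \<open>M j k\<close>.\<close>

definition block_op ::
    "('n \<Rightarrow> 'n \<Rightarrow> 'a \<Rightarrow> 'a) \<Rightarrow> 'a::complex_hilbert ^ 'n \<Rightarrow> 'a ^ 'n::finite"
  where "block_op M x = (\<chi> j. \<Sum>k\<in>UNIV. M j k (x $ k))"

definition block_diag ::
    "('a \<Rightarrow> 'a) \<Rightarrow> 'n \<Rightarrow> 'n \<Rightarrow> 'a::complex_hilbert \<Rightarrow> 'a"
  where "block_diag A j k = (if j = k then A else (\<lambda>_. 0))"

definition slcirc ::
    "(nat \<Rightarrow> 'a \<Rightarrow> 'a) \<Rightarrow> 'n::{finite,linorder} \<Rightarrow> 'n \<Rightarrow> 'a::complex_hilbert \<Rightarrow> 'a"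
  where "slcirc T j k =
    (if idx j + idx k \<le> CARD('n) + 1
     then T (idx j + idx k - 1)
     else (\<lambda>x. - T (idx j + idx k - 1 - CARD('n)) x))"

end

theory Submission
  imports Defs
begin

text \<open>
  The two operator matrices are unitarily equivalent, through a unitary that commutes with the
  diagonal weight; such an equivalence preserves both the set of vectors of \<open>A\<close>-norm 1 and
  the values of the quadratic form on it, hence the numerical radius
  (\<open>A_numerical_radius_similar\<close>).

  The unitary is a discrete Fourier transform twisted by \<open>\<sigma>\<close>. The numbers
  \<open>s\<^sub>k = \<sigma> \<omega> ^ (k - 1)\<close> are the \<open>n\<close> roots of \<open>z ^ n = -1\<close>. If \<open>c\<close> is such a root, the sign
  changes below the anti-diagonal are exactly those that \<open>c\<close> produces when an exponent is reduced
  by \<open>n\<close>. The skew left circulant matrix therefore sends the vector \<open>(c ^ k z)\<^sub>k\<close> to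
  \<open>(c ^ (-j) \<Sum>\<^sub>i c ^ (i + 1) T\<^sub>i z)\<^sub>j\<close> (\<open>sum_slcirc_geometric\<close>): it turns the geometric vector
  of ratio \<open>c\<close> into one of ratio \<open>1 / c\<close>. Normalised by \<open>1 / sqrt n\<close>, the geometric vectors are
  the columns of a unitary matrix (\<open>sum_cnj_geometric_columns\<close>), and in this basis the skew left
  circulant matrix pairs the root \<open>c\<close> with the root \<open>1 / c = cnj c\<close>. As
  \<open>cnj s\<^sub>k = s\<^sub>n\<^sub>+\<^sub>1\<^sub>-\<^sub>k\<close>, that pairing lies along the anti-diagonal.
\<close>

section \<open>Linear maps and the complex inner product\<close>

lemma scaleC_zero_left [simp]: "0 *\<^sub>C x = (0::'a::complex_inner)"
  using scaleC_of_real[of 0 x] by simp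

lemma scaleC_one [simp]: "1 *\<^sub>C x = (x::'a::complex_inner)"
  using scaleC_of_real[of 1 x] by simp

lemma scaleC_zero_right [simp]: "c *\<^sub>C 0 = (0::'a::complex_inner)"
  using scaleC_add_right[of c "0::'a" 0] by simp

lemma scaleC_minus_left: "(- c) *\<^sub>C x = - (c *\<^sub>C x :: 'a::complex_inner)"
  using scaleC_add_left[of "- c" c x] by (simp add: eq_neg_iff_add_eq_0)

lemma scaleC_minus_right: "c *\<^sub>C (- x) = - (c *\<^sub>C x :: 'a::complex_inner)"
  using scaleC_add_right[of c "- x" x] by (simp add: eq_neg_iff_add_eq_0)

lemma scaleC_sum_left: "(\<Sum>i\<in>I. f i) *\<^sub>C x = (\<Sum>i\<in>I. f i *\<^sub>C x :: 'a::complex_inner)"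
  by (induction I rule: infinite_finite_induct) (simp_all add: scaleC_add_left)

lemma scaleC_sum_right: "c *\<^sub>C (\<Sum>i\<in>I. f i) = (\<Sum>i\<in>I. c *\<^sub>C f i :: 'a::complex_inner)"
  by (induction I rule: infinite_finite_induct) (simp_all add: scaleC_add_right)

lemma cinner_zero_left [simp]: "cinner 0 (y::'a::complex_inner) = 0"
  using cinner_add_left[of 0 0 y] by simp

lemma cinner_sum_left: "cinner (\<Sum>i\<in>I. f i) (y::'a::complex_inner) = (\<Sum>i\<in>I. cinner (f i) y)"
  by (induction I rule: infinite_finite_induct) (simp_all add: cinner_add_left)

lemma cinner_sum_right: "cinner (y::'a::complex_inner) (\<Sum>i\<in>I. f i) = (\<Sum>i\<in>I. cinner y (f i))"
  by (subst cinner_commute, simp add: cinner_sum_left, intro sum.cong refl cinner_commute[symmetric])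

lemma cinner_scaleC_right: "cinner (x::'a::complex_inner) (c *\<^sub>C y) = cnj c * cinner x y"
  by (subst cinner_commute, simp add: cinner_scaleC_left cinner_commute[of x y])

lemma bounded_clinear_sum: "bounded_clinear T \<Longrightarrow> T (\<Sum>i\<in>I. f i) = (\<Sum>i\<in>I. T (f i))"
  by (simp add: bounded_clinear_def linear_sum bounded_linear.linear)

lemma bounded_clinear_scaleC: "bounded_clinear T \<Longrightarrow> T (c *\<^sub>C x) = c *\<^sub>C T x"
  by (simp add: bounded_clinear_def)

section \<open>Invariance of the numerical radius under unitary equivalence\<close>

lemma A_numerical_radius_similar:
  fixes A U T S :: "'a::complex_hilbert \<Rightarrow> 'a"
  assumes "surj U"
    and isometry: "\<And>x y. A_inner A (U x) (U y) = A_inner A x y"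
    and intertwines: "\<And>x. T (U x) = U (S x)"
  shows "A_numerical_radius A T = A_numerical_radius A S"
proof -
  have "{x. A_norm A x = 1} = U ` {y. A_norm A y = 1}"
    using \<open>surj U\<close> by (auto simp: A_norm_def isometry image_iff) (metis isometry surjD)
  then have SUP_image: "(SUP x\<in>{x. A_norm A x = 1}. f x) = (SUP y\<in>{y. A_norm A y = 1}. f (U y))"
    for f :: "'a \<Rightarrow> ennreal"
    by (metis image_image)
  show ?thesis
    unfolding A_numerical_radius_def
    by (subst SUP_image) (simp only: intertwines isometry)
qed

definition scalar_op :: "('n \<Rightarrow> 'n \<Rightarrow> complex) \<Rightarrow> 'a::complex_hilbert ^ 'n \<Rightarrow> 'a ^ 'n::finite"
  where "scalar_op u = block_op (\<lambda>k m x. u k m *\<^sub>C x)"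

lemma scalar_op_nth: "scalar_op u x $ k = (\<Sum>m\<in>UNIV. u k m *\<^sub>C x $ m)"
  by (simp add: scalar_op_def block_op_def)

lemma block_op_block_diag_nth:
  "block_op (block_diag A) x $ k = (A (x $ k) :: 'a::complex_hilbert)"
proof -
  have "block_op (block_diag A) x $ k = (\<Sum>j\<in>UNIV. if k = j then A (x $ j) else 0)"
    unfolding block_op_def by (simp add: block_diag_def if_distribR)
  then show ?thesis by simp
qed

lemma scalar_op_block_diag:
  fixes x :: "'a::complex_hilbert ^ 'n::finite"
  assumes "bounded_clinear A"
  shows "block_op (block_diag A) (scalar_op u x) = scalar_op u (block_op (block_diag A) x)"
  by (simp add: vec_eq_iff block_op_block_diag_nth scalar_op_nth bounded_clinear_sum[OF assms]
      bounded_clinear_scaleC[OF assms])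

lemma cinner_scalar_op:
  fixes x y :: "'a::complex_hilbert ^ 'n::finite"
  assumes orthonormal: "\<And>m p. (\<Sum>k\<in>UNIV. cnj (u k m) * u k p) = (if m = p then 1 else 0)"
  shows "cinner (scalar_op u x) (scalar_op u y) = cinner x y"
proof -
  have "cinner (scalar_op u x) (scalar_op u y)
      = (\<Sum>k\<in>UNIV. \<Sum>m\<in>UNIV. \<Sum>p\<in>UNIV. cnj (u k m) * u k p * cinner (x $ p) (y $ m))"
    by (simp add: cinner_vec_def scalar_op_nth cinner_sum_left cinner_sum_right
        cinner_scaleC_left cinner_scaleC_right sum_distrib_left mult_ac)
  also have "\<dots> = (\<Sum>m\<in>UNIV. \<Sum>p\<in>UNIV. \<Sum>k\<in>UNIV. cnj (u k m) * u k p * cinner (x $ p) (y $ m))"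
    by (subst sum.swap) (intro sum.cong refl sum.swap)
  also have "\<dots> = (\<Sum>m\<in>UNIV. \<Sum>p\<in>UNIV. if m = p then cinner (x $ p) (y $ m) else 0)"
    by (intro sum.cong refl) (simp add: orthonormal flip: sum_distrib_right)
  finally show ?thesis by (simp add: cinner_vec_def)
qed

text \<open>Orthonormal columns give a left inverse; since the matrix is square and has scalar entries,
  this is also a right inverse, whatever the dimension of the underlying Hilbert space.\<close>

lemma surj_scalar_op:
  assumes orthonormal: "\<And>m p. (\<Sum>k\<in>UNIV. cnj (u k m) * u k p) = (if m = p then 1 else 0)"
  shows "surj (scalar_op u :: 'a::complex_hilbert ^ 'n::finite \<Rightarrow> 'a ^ 'n)"
proof -
  define M :: "complex ^ 'n ^ 'n" where "M = (\<chi> k m. u k m)"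
  define M' :: "complex ^ 'n ^ 'n" where "M' = (\<chi> m k. cnj (u k m))"
  have "M' ** M = mat 1"
    by (simp add: M_def M'_def matrix_matrix_mult_def mat_def vec_eq_iff orthonormal)
  then have "M ** M' = mat 1"
    by (simp add: matrix_left_right_inverse)
  then have rows: "(\<Sum>m\<in>UNIV. u k m * cnj (u l m)) = (if k = l then 1 else 0)" for k l
    by (simp add: M_def M'_def matrix_matrix_mult_def mat_def vec_eq_iff)
  have "scalar_op u (scalar_op (\<lambda>m k. cnj (u k m)) y) = y" for y :: "'a ^ 'n"
  proof (rule vec_eq_iff[THEN iffD2], rule allI)
    fix k
    have "scalar_op u (scalar_op (\<lambda>m k. cnj (u k m)) y) $ k
        = (\<Sum>m\<in>UNIV. \<Sum>l\<in>UNIV. (u k m * cnj (u l m)) *\<^sub>C y $ l)"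
      by (simp add: scalar_op_nth scaleC_sum_right scaleC_scaleC)
    also have "\<dots> = (\<Sum>l\<in>UNIV. (if k = l then 1 else 0) *\<^sub>C y $ l)"
      by (subst sum.swap) (simp add: rows flip: scaleC_sum_left)
    also have "\<dots> = (\<Sum>l\<in>UNIV. if k = l then y $ l else 0)"
      by (intro sum.cong) auto
    finally show "scalar_op u (scalar_op (\<lambda>m k. cnj (u k m)) y) $ k = y $ k" by simp
  qed
  then show ?thesis by (metis surjI)
qed

lemma A_numerical_radius_scalar_op_similar:
  fixes T S :: "'a::complex_hilbert ^ 'n::finite \<Rightarrow> 'a ^ 'n"
  assumes "bounded_clinear A"
    and orthonormal: "\<And>m p. (\<Sum>k\<in>UNIV. cnj (u k m) * u k p) = (if m = p then 1 else 0)"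
    and "\<And>x. T (scalar_op u x) = scalar_op u (S x)"
  shows "A_numerical_radius (block_op (block_diag A)) T
       = A_numerical_radius (block_op (block_diag A)) S"
  using surj_scalar_op[OF orthonormal] _ assms(3)
  by (rule A_numerical_radius_similar)
    (simp add: A_inner_def scalar_op_block_diag[OF assms(1)] cinner_scalar_op[OF orthonormal])

section \<open>The index type and its reversal\<close>

lemma idx_bounds: "1 \<le> idx k" "idx (k :: 'n::{finite,linorder}) \<le> CARD('n)"
  using bij_betw_idx[where 'n='n] by (auto simp: bij_betw_def)

lemma idx_eq_iff [simp]: "idx k = idx l \<longleftrightarrow> k = (l :: 'n::{finite,linorder})"
  using bij_betw_idx[where 'n='n] by (auto simp: bij_betw_def inj_eq)

lemma sum_idx: "(\<Sum>k::'n::{finite,linorder}\<in>UNIV. f (idx k)) = (\<Sum>k=1..CARD('n). f k)"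
  by (rule sum.reindex_bij_betw[OF bij_betw_idx])

definition rev_idx :: "'n::{finite,linorder} \<Rightarrow> 'n"
  where "rev_idx k = inv idx (CARD('n) + 1 - idx k)"

lemma idx_rev_idx: "idx (rev_idx k) = CARD('n) + 1 - idx (k :: 'n::{finite,linorder})"
proof -
  have "CARD('n) + 1 - idx k \<in> range (idx :: 'n \<Rightarrow> nat)"
    using bij_betw_idx[where 'n='n] idx_bounds[of k] by (auto simp: bij_betw_def)
  then show ?thesis unfolding rev_idx_def by (rule f_inv_into_f)
qed

lemma rev_idx_rev_idx [simp]: "rev_idx (rev_idx k) = (k :: 'n::{finite,linorder})"
  using idx_bounds[of k] by (simp flip: idx_eq_iff add: idx_rev_idx)

lemma sum_rev_idx: "(\<Sum>k\<in>UNIV. f (rev_idx k)) = (\<Sum>k\<in>(UNIV :: 'n::{finite,linorder} set). f k)"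
  by (rule sum.reindex_bij_witness[of _ rev_idx rev_idx]) auto

lemma block_op_antidiagonal_nth:
  fixes x :: "'a::complex_hilbert ^ 'n::{finite,linorder}"
  shows "block_op (\<lambda>k l. if idx l = CARD('n) + 1 - idx k then F k else (\<lambda>_. 0)) x $ k
       = F k (x $ rev_idx k)"
proof -
  have "idx l = CARD('n) + 1 - idx k \<longleftrightarrow> l = rev_idx k" for l :: 'n
    by (simp only: idx_eq_iff flip: idx_rev_idx)
  then have "block_op (\<lambda>k l. if idx l = CARD('n) + 1 - idx k then F k else (\<lambda>_. 0)) x $ k
       = (\<Sum>l\<in>UNIV. if l = rev_idx k then F k (x $ l) else 0)"
    unfolding block_op_def by (simp add: if_distribR)
  then show ?thesis by simp
qed

section \<open>The roots of minus one\<close>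

text \<open>The root \<open>\<sigma> \<omega> ^ (k - 1)\<close> in polar form.\<close>

definition neg_root :: "'n::{finite,linorder} \<Rightarrow> complex"
  where "neg_root (k::'n) = cis (pi * (2 * real (idx k) - 1) / real CARD('n))"

lemma neg_root_eq:
  fixes k :: "'n::{finite,linorder}"
  shows "exp (of_real pi * \<i> / of_nat CARD('n)) * exp (2 * of_real pi * \<i> / of_nat CARD('n)) ^ (idx k - 1)
    = neg_root k"
proof -
  have "exp (of_real pi * \<i> / of_nat CARD('n)) = cis (pi / real CARD('n))"
    "exp (2 * of_real pi * \<i> / of_nat CARD('n)) = cis (2 * pi / real CARD('n))"
    by (simp_all add: cis_conv_exp mult_ac)
  moreover have "pi / real CARD('n) + real (idx k - 1) * (2 * pi / real CARD('n))
      = pi * (2 * real (idx k) - 1) / real CARD('n)"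
    using idx_bounds(1)[of k] by (simp add: of_nat_diff field_simps)
  ultimately show ?thesis
    by (simp only: neg_root_def Complex.DeMoivre cis_mult)
qed

lemma neg_root_power_card: "neg_root k ^ CARD('n) = - 1" for k :: "'n::{finite,linorder}"
proof -
  have "real CARD('n) * (pi * (2 * real (idx k) - 1) / real CARD('n))
      = 2 * pi * of_int (int (idx k)) - pi"
    by (simp add: field_simps)
  then have "neg_root k ^ CARD('n) = cis (2 * pi * of_int (int (idx k)) - pi)"
    by (simp only: neg_root_def Complex.DeMoivre)
  also have "\<dots> = cis (2 * pi * of_int (int (idx k))) / cis pi"
    by (simp only: cis_divide)
  also have "cis (2 * pi * of_int (int (idx k))) = 1"
    by (rule cis_multiple_2pi) simp
  finally show ?thesis by simp
qed

lemma cnj_neg_root_mult: "cnj (neg_root k) * neg_root k = 1"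
  by (simp add: neg_root_def cis_cnj cis_mult)

lemma neg_root_rev_idx: "neg_root (rev_idx k) = cnj (neg_root (k :: 'n::{finite,linorder}))"
proof -
  have "pi * (2 * real (idx (rev_idx k)) - 1) / real CARD('n)
      = 2 * pi + - (pi * (2 * real (idx k) - 1) / real CARD('n))"
    using idx_bounds(2)[of k] by (simp add: idx_rev_idx of_nat_diff field_simps)
  then show ?thesis
    by (simp only: neg_root_def cis_cnj flip: cis_mult) simp
qed

lemma neg_root_eq_iff: "neg_root k = neg_root l \<longleftrightarrow> k = (l :: 'n::{finite,linorder})"
proof
  assume eq: "neg_root k = neg_root l"
  let ?r = "\<lambda>m. cis (2 * pi * real m / real CARD('n))"
  \<comment> \<open>Up to the factor \<open>\<sigma>\<close>, these are the roots of unity with exponents below \<open>n\<close>.\<close>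
  have r: "neg_root m = cis (pi / real CARD('n)) * ?r (idx m - 1)" for m :: 'n
    using idx_bounds(1)[of m]
    by (simp add: neg_root_def cis_mult of_nat_diff diff_divide_distrib add_divide_distrib algebra_simps)
  have "?r (idx k - 1) = ?r (idx l - 1)"
    using eq by (simp add: r)
  moreover have "inj_on ?r {..<CARD('n)}"
    using bij_betw_imp_inj_on[OF Complex.bij_betw_roots_unity[of "CARD('n)"]] by simp
  moreover have "idx m - 1 \<in> {..<CARD('n)}" for m :: 'n
    using idx_bounds[of m] by auto
  ultimately have "idx k - 1 = idx l - 1"
    by (auto dest: inj_onD)
  then show "k = l"
    using idx_bounds(1)[of k] idx_bounds(1)[of l] by (simp flip: idx_eq_iff)
qed simp

section \<open>The Fourier matrix of geometric columns\<close>

definition neg_fourier :: "'n::{finite,linorder} \<Rightarrow> 'n \<Rightarrow> complex"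
  where "neg_fourier k (m::'n) = cnj (neg_root m) ^ idx k / of_real (sqrt (real CARD('n)))"

text \<open>The quotient of two roots of \<open>-1\<close> is a root of unity, so off the diagonal the geometric
  sum vanishes.\<close>

lemma sum_cnj_geometric_columns:
  fixes m p :: "'n::{finite,linorder}"
  shows "(\<Sum>k\<in>UNIV. cnj (neg_fourier k m) * neg_fourier k p) = (if m = p then 1 else 0)"
proof -
  define q where "q = neg_root m * cnj (neg_root p)"
  let ?n = "CARD('n)"
  have sq: "complex_of_real (sqrt (real ?n)) * complex_of_real (sqrt (real ?n)) = of_nat ?n"
    by (simp flip: of_real_mult)
  have "(\<Sum>k\<in>UNIV. cnj (neg_fourier k m) * neg_fourier k p)
      = (\<Sum>k::'n\<in>UNIV. q ^ idx k) / of_nat ?n"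
    by (simp add: neg_fourier_def q_def power_mult_distrib sum_divide_distrib sq)
  also have "(\<Sum>k::'n\<in>UNIV. q ^ idx k) = (\<Sum>k=1..?n. q ^ k)"
    by (rule sum_idx)
  also have "\<dots> = (if m = p then of_nat ?n else 0)"
  proof (cases "m = p")
    case True
    then have "q = 1"
      using cnj_neg_root_mult[of p] by (simp add: q_def mult.commute)
    with True show ?thesis by simp
  next
    case False
    have "q \<noteq> 1"
    proof
      assume "q = 1"
      have "neg_root m = q * neg_root p"
        using cnj_neg_root_mult[of p] by (simp add: q_def mult.assoc)
      with \<open>q = 1\<close> False show False by (simp add: neg_root_eq_iff)
    qed
    moreover have "q ^ ?n = 1"
      by (simp add: q_def power_mult_distrib neg_root_power_card flip: complex_cnj_power)
    ultimately show ?thesis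
      using False by (simp add: sum_gp)
  qed
  finally show ?thesis by simp
qed

text \<open>The entry of row \<open>j\<close> and column \<open>k\<close> is \<open>T i\<close> with \<open>i + 1 = j + k\<close>, or \<open>- T i\<close> with
  \<open>i + 1 = j + k - n\<close>. In both cases \<open>\<plusminus> c ^ k = c ^ (i + 1) / c ^ j\<close>, because \<open>c ^ n = -1\<close>, and
  \<open>i\<close> runs through \<open>1, \<dots>, n\<close> when \<open>k\<close> does.\<close>

lemma sum_slcirc_geometric:
  fixes j :: "'n::{finite,linorder}" and z :: "'a::complex_hilbert"
  assumes c: "c ^ CARD('n) = - 1" and d: "d * c = 1"
  shows "(\<Sum>k\<in>UNIV. c ^ idx k *\<^sub>C slcirc T j k z)
       = d ^ idx j *\<^sub>C (\<Sum>i=1..CARD('n). c ^ (i + 1) *\<^sub>C T i z)"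
proof -
  let ?n = "CARD('n)"
  have j: "1 \<le> idx j" "idx j \<le> ?n" by (rule idx_bounds)+
  have shift: "d ^ idx j * c ^ (idx j + k) = c ^ k" for k
    using d by (simp add: power_add flip: mult.assoc power_mult_distrib)
  define f where "f k = (if idx j + k \<le> ?n + 1 then c ^ k *\<^sub>C T (idx j + k - 1) z
    else - (c ^ k *\<^sub>C T (idx j + k - 1 - ?n) z))" for k
  have "(\<Sum>k\<in>UNIV. c ^ idx k *\<^sub>C slcirc T j k z) = (\<Sum>k::'n\<in>UNIV. f (idx k))"
    by (intro sum.cong) (simp_all add: slcirc_def f_def scaleC_minus_right)
  also have "\<dots> = (\<Sum>k=1..?n. f k)"
    by (rule sum_idx)
  also have "\<dots> = (\<Sum>i=1..?n. (d ^ idx j * c ^ (i + 1)) *\<^sub>C T i z)"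
  proof (rule sum.reindex_bij_witness[of _
        "\<lambda>i. if idx j \<le> i then i + 1 - idx j else i + 1 + ?n - idx j"
        "\<lambda>k. if idx j + k \<le> ?n + 1 then idx j + k - 1 else idx j + k - 1 - ?n"])
    fix k assume k: "k \<in> {1..?n}"
    show "(d ^ idx j * c ^ ((if idx j + k \<le> ?n + 1 then idx j + k - 1 else idx j + k - 1 - ?n) + 1))
        *\<^sub>C T (if idx j + k \<le> ?n + 1 then idx j + k - 1 else idx j + k - 1 - ?n) z = f k"
    proof (cases "idx j + k \<le> ?n + 1")
      case True
      then show ?thesis using j k by (simp add: f_def shift)
    next
      case False
      define i where "i = idx j + k - 1 - ?n"
      have "idx j + k = (i + 1) + ?n"
        using False by (simp add: i_def)
      then have "c ^ (idx j + k) = - (c ^ (i + 1))"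
        by (simp only: power_add c) simp
      then have "d ^ idx j * c ^ (i + 1) = - (c ^ k)"
        using shift[of k] by (metis minus_minus mult_minus_right)
      then show ?thesis
        using False by (simp only: f_def i_def if_False scaleC_minus_left)
    qed
  qed (use j in \<open>auto split: if_splits\<close>)
  finally show ?thesis
    by (simp add: scaleC_sum_right scaleC_scaleC)
qed

lemma slcirc_scaleC_sum:
  fixes j k :: "'n::{finite,linorder}" and y :: "'i \<Rightarrow> 'a::complex_hilbert"
  assumes "\<And>i. 1 \<le> i \<Longrightarrow> i \<le> CARD('n) \<Longrightarrow> bounded_clinear (T i)"
  shows "slcirc T j k (\<Sum>m\<in>I. a m *\<^sub>C y m) = (\<Sum>m\<in>I. a m *\<^sub>C slcirc T j k (y m))"
proof -
  have T: "bounded_clinear (T i) \<Longrightarrow> T i (\<Sum>m\<in>I. a m *\<^sub>C y m) = (\<Sum>m\<in>I. a m *\<^sub>C T i (y m))" for i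
    by (simp add: bounded_clinear_sum bounded_clinear_scaleC)
  show ?thesis
  proof (cases "idx j + idx k \<le> CARD('n) + 1")
    case True
    then have "bounded_clinear (T (idx j + idx k - 1))"
      using idx_bounds[of j] idx_bounds[of k] by (intro assms) auto
    with True show ?thesis by (simp add: slcirc_def T)
  next
    case False
    then have "bounded_clinear (T (idx j + idx k - 1 - CARD('n)))"
      using idx_bounds[of j] idx_bounds[of k] by (intro assms) auto
    with False show ?thesis by (simp add: slcirc_def T scaleC_minus_right sum_negf)
  qed
qed

text \<open>The \<open>m\<close>-th column of the Fourier matrix is geometric of ratio \<open>cnj (neg_root m)\<close>, so its
  image is geometric of ratio \<open>neg_root m\<close>, that is, the column with the reversed index carrying
  an operator coefficient. Reindexing by the reversal puts the coefficients on the anti-diagonal.\<close>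

lemma slcirc_neg_fourier:
  fixes x :: "'a::complex_hilbert ^ 'n::{finite,linorder}"
  assumes T: "\<And>i. 1 \<le> i \<Longrightarrow> i \<le> CARD('n) \<Longrightarrow> bounded_clinear (T i)"
  shows "block_op (slcirc T) (scalar_op neg_fourier x)
       = scalar_op neg_fourier (block_op (\<lambda>k l. if idx l = CARD('n) + 1 - idx k
           then (\<lambda>z. \<Sum>i=1..CARD('n). neg_root k ^ (i + 1) *\<^sub>C T i z) else (\<lambda>_. 0)) x)"
    (is "_ = scalar_op _ (block_op ?E x)")
proof (rule vec_eq_iff[THEN iffD2], rule allI)
  fix j :: 'n
  let ?r = "complex_of_real (sqrt (real CARD('n)))"
  define G where "G m y = (1 / ?r) *\<^sub>C neg_root m ^ idx j *\<^sub>C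
      (\<Sum>i=1..CARD('n). cnj (neg_root m) ^ (i + 1) *\<^sub>C T i y)" for m :: 'n and y :: 'a
  have column: "(\<Sum>k\<in>UNIV. neg_fourier k m *\<^sub>C slcirc T j k y) = G m y" for m y
  proof -
    have "cnj (neg_root m) ^ CARD('n) = - 1"
      by (simp add: neg_root_power_card flip: complex_cnj_power)
    moreover have "neg_root m * cnj (neg_root m) = 1"
      using cnj_neg_root_mult[of m] by (simp add: mult.commute)
    ultimately have "(\<Sum>k\<in>UNIV. cnj (neg_root m) ^ idx k *\<^sub>C slcirc T j k y)
        = neg_root m ^ idx j *\<^sub>C (\<Sum>i=1..CARD('n). cnj (neg_root m) ^ (i + 1) *\<^sub>C T i y)"
      by (rule sum_slcirc_geometric)
    moreover have "(\<Sum>k\<in>UNIV. neg_fourier k m *\<^sub>C slcirc T j k y)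
        = (1 / ?r) *\<^sub>C (\<Sum>k\<in>UNIV. cnj (neg_root m) ^ idx k *\<^sub>C slcirc T j k y)"
      by (simp add: neg_fourier_def scaleC_sum_right scaleC_scaleC)
    ultimately show ?thesis by (simp only: G_def)
  qed
  have "block_op (slcirc T) (scalar_op neg_fourier x) $ j
      = (\<Sum>k\<in>UNIV. \<Sum>m\<in>UNIV. neg_fourier k m *\<^sub>C slcirc T j k (x $ m))"
    unfolding block_op_def by (simp add: scalar_op_nth slcirc_scaleC_sum[OF T])
  also have "\<dots> = (\<Sum>m\<in>UNIV. G m (x $ m))"
    by (subst sum.swap) (simp add: column)
  also have "\<dots> = (\<Sum>k\<in>UNIV. G (rev_idx k) (x $ rev_idx k))"
    by (rule sum_rev_idx[symmetric])
  also have "\<dots> = (\<Sum>k\<in>UNIV. neg_fourier j k *\<^sub>C block_op ?E x $ k)"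
    by (intro sum.cong refl, subst block_op_antidiagonal_nth)
      (simp add: G_def neg_root_rev_idx neg_fourier_def scaleC_scaleC)
  finally show "block_op (slcirc T) (scalar_op neg_fourier x) $ j
      = scalar_op neg_fourier (block_op ?E x) $ j"
    by (simp only: scalar_op_nth)
qed

theorem theorem3p2:
  fixes A :: "'a::complex_hilbert \<Rightarrow> 'a"
    and T :: "nat \<Rightarrow> 'a \<Rightarrow> 'a"
    and E :: "'n::{finite,linorder} \<Rightarrow> 'n \<Rightarrow> 'a \<Rightarrow> 'a"
    and \<sigma> \<omega> :: complex
  assumes "positive_op A"
    and "\<And>i. 1 \<le> i \<Longrightarrow> i \<le> CARD('n) \<Longrightarrow> T i \<in> A_adjointable A"
    and "\<sigma> = exp (of_real pi * \<i> / of_nat CARD('n))"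
    and "\<omega> = exp (2 * of_real pi * \<i> / of_nat CARD('n))"
    and "E = (\<lambda>k l. if idx l = CARD('n) + 1 - idx k
                    then (\<lambda>x. \<Sum>i=1..CARD('n). (\<sigma> * \<omega> ^ (idx k - 1)) ^ (i + 1) *\<^sub>C T i x)
                    else (\<lambda>_. 0))"
  shows "A_numerical_radius (block_op (block_diag A)) (block_op (slcirc T) :: ('a, 'n) vec \<Rightarrow> ('a, 'n) vec)
       = A_numerical_radius (block_op (block_diag A)) (block_op E)"
proof -
  have "bounded_clinear A"
    using assms(1) by (simp add: positive_op_def)
  moreover have "bounded_clinear (T i)" if "1 \<le> i" "i \<le> CARD('n)" for i
    using assms(2)[OF that] by (simp add: A_adjointable_def)
  then have "block_op (slcirc T) (scalar_op neg_fourier x)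
      = scalar_op neg_fourier (block_op E x)" for x :: "('a, 'n) vec"
    unfolding assms(3-5) neg_root_eq by (rule slcirc_neg_fourier)
  ultimately show ?thesis
    using sum_cnj_geometric_columns by (intro A_numerical_radius_scalar_op_similar)
qed

end
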